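(* Let $f:X\to\mathcal P(Z)$ be a set-valued function. The following statements are equivalent: (i) $f$ is the pointwise supremum of its $\mathcal C$-affine minorants, i.e. $f(x)+K=\bigcap_{a\in\mathcal C_f}(a(x)+K)$ for all $x\in X$; (ii) $f$ is $K$-e-convex and either $f_K$ is proper, or $f_K\equiv\emptyset$, or $f_K\equiv Z$.
   Context: $X$ and $Z$ are nontrivial real separated (Hausdorff) locally convex spaces with topological duals $X^*,Z^*$ and duality pairings $\langle\cdot,\cdot\rangle$. $K\subset Z$ is a fixed convex cone with $\{0\}\subsetneq K\subsetneq Z$, and $K^*=\{z^*\in Z^*:\langle z,z^*\rangle\le 0\ \forall z\in K\}$. $\mathcal P(Z)$ is the set of all subsets of $Z$ (including $\emptyset$); $A+B$ is the Minkowski sum, with $A+\emptyset=\emptyset$. For $A,B\subseteq Z$, $A\le_K B$ means $B\subseteq A+K$. A subset $C$ of a locally convex space $Y$ is e-convex if it is the intersection of a (possibly empty) family of open half-spaces; equivalently, for every $y_0\notin C$ there is $y^*\in Y^*$ with $\langle y-y_0,y^*\rangle<0$ for all $y\in C$. $\operatorname{e-conv}C$ is the smallest e-convex set containing $C$. $\mathcal R_K(Z)=\{A\subseteq Z: A=\operatorname{e-conv}(A+K)\}$. For $f:X\to\mathcal P(Z)$: $f_K(x)=f(x)+K$; $\operatorname{dom}f=\{x: f(x)\ne\emptyset\}$; $f$ is proper if $\operatorname{dom}f\neq\emptyset$ and $f(x)\ne Z$ for all $x\in\operatorname{dom}f$; $\operatorname{epi}_Kf=\{(x,z)\in X\times Z: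 z\in f(x)+K\}$; $f$ is $K$-e-convex if $\operatorname{epi}_Kf$ is an e-convex set in $X\times Z$. For $x^*\in X^*$, $z^*\in K^*\setminus\{0\}$: $S_{(x^*,z^* )}(x)=\{z\in Z:\langle x,x^*\rangle+\langle z,z^*\rangle<0\}$. For $C\subseteq X$, $a:X\to\mathcal P(Z)$ is $C$-affine if there are $x^*\in X^*$, $z^*\in K^*\setminus\{0\}$, $\tilde z\in Z$ with $a(x)=S_{(x^*,z^* )}(x)+\tilde z$ for $x\in C$ and $a(x)=\emptyset$ otherwise. Let $\mathcal C$ be the set of all e-convex subsets of $X$; $a:X\to\mathcal R_K(Z)$ is $\mathcal C$-affine if it is $C$-affine for some $C\in\mathcal C$. $\mathcal C_f$ is the set of all $\mathcal C$-affine functions $a$ with $a(x)\le_K f(x)$ for all $x\in X$ (the $\mathcal C$-affine minorants of $f$). The intersection (supremum) over an empty family is $Z$.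
   Formalization: Adds the hypothesis that K* ≠ {0} when f ≡ ∅; without it the claim fails: if K is dense (e.g. the kernel of a discontinuous functional) then K* = {0}, there are no 𝒞-affine minorants, the supremum is Z, yet (ii) holds for f ≡ ∅. *)

theory Defs
  imports "HOL-Analysis.Analysis"
begin

text \<open>
  Real separated locally convex spaces.  Local convexity is stated at the origin, which suffices
  because translations are homeomorphisms.  Convexity of \<open>V\<close> is spelled out there because
  \<open>convex\<close> is not available inside a class specification.
\<close>

class locally_convex_space = real_vector + t2_space + topological_ab_group_add +
  assumes tendsto_scaleR_Pair:
    "LIM p (nhds a \<times>\<^sub>F nhds x). fst p *\<^sub>R snd p :> nhds (a *\<^sub>R x)"
  assumes locally_convex_0:
    "open U \<Longrightarrow> 0 \<in> U \<Longrightarrow>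
      \<exists>V. open V \<and> 0 \<in> V \<and> V \<subseteq> U \<and>
        (\<forall>x\<in>V. \<forall>y\<in>V. \<forall>u\<ge>0. \<forall>v\<ge>0. u + v = 1 \<longrightarrow> u *\<^sub>R x + v *\<^sub>R y \<in> V)"

lemma locally_convex_0_convex:
  fixes U :: "'a::locally_convex_space set"
  assumes "open U" "0 \<in> U"
  shows "\<exists>V. open V \<and> convex V \<and> 0 \<in> V \<and> V \<subseteq> U"
  proof -
  obtain V where "open V" "0 \<in> V" "V \<subseteq> U"
    and V: "\<forall>x\<in>V. \<forall>y\<in>V. \<forall>u\<ge>0. \<forall>v\<ge>0. u + v = 1 \<longrightarrow> u *\<^sub>R x + v *\<^sub>R y \<in> V"
    using locally_convex_0[OF assms] by (elim exE conjE)
  moreover have "convex V"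
    unfolding convex_def by (rule V)
  ultimately show ?thesis
    by (intro exI[of _ V] conjI)
qed

lemma topological_add_prod:
  fixes a b :: "'a::topological_monoid_add \<times> 'b::topological_monoid_add"
  shows "LIM p (nhds a \<times>\<^sub>F nhds b). fst p + snd p :> nhds (a + b)"
proof -
  have fst_lim: "((\<lambda>p. fst p) \<longlongrightarrow> a) (nhds a \<times>\<^sub>F nhds b)"
    by (rule filterlim_fst)
  have snd_lim: "((\<lambda>p. snd p) \<longlongrightarrow> b) (nhds a \<times>\<^sub>F nhds b)"
    by (rule filterlim_snd)
  have "((\<lambda>p. (fst (fst p) + fst (snd p), snd (fst p) + snd (snd p)))
      \<longlongrightarrow> (fst a + fst b, snd a + snd b)) (nhds a \<times>\<^sub>F nhds b)"
    by (intro tendsto_Pair tendsto_add tendsto_fst tendsto_snd fst_lim snd_lim)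
  then show ?thesis
    by (simp add: plus_prod_def)
qed

instance prod :: (topological_monoid_add, topological_monoid_add) topological_monoid_add
  by standard (rule topological_add_prod)

instance prod :: (topological_group_add, topological_group_add) topological_group_add
proof
  fix a :: "'a \<times> 'b"
  have "((\<lambda>p. (- fst p, - snd p)) \<longlongrightarrow> (- fst a, - snd a)) (nhds a)"
    by (intro tendsto_Pair tendsto_minus tendsto_fst tendsto_snd filterlim_ident)
  then show "(uminus \<longlongrightarrow> - a) (nhds a)"
    by (simp add: uminus_prod_def[abs_def])
qed

instance prod :: (topological_ab_group_add, topological_ab_group_add) topological_ab_group_add ..

lemma tendsto_scaleR_lcs:
  fixes x :: "'a::locally_convex_space"
  assumes "(c \<longlongrightarrow> a) F" "(g \<longlongrightarrow> x) F"
  shows "((\<lambda>t. c t *\<^sub>R g t) \<longlongrightarrow> a *\<^sub>R x) F"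
  using filterlim_compose[OF tendsto_scaleR_Pair, of "\<lambda>t. (c t, g t)" a x F] assms
  by (simp add: nhds_prod[symmetric] tendsto_Pair)

instance prod :: (locally_convex_space, locally_convex_space) locally_convex_space
proof
  fix a :: real and x :: "'a \<times> 'b"
  have fst_lim: "((\<lambda>p. fst p) \<longlongrightarrow> a) (nhds a \<times>\<^sub>F nhds x)"
    by (rule filterlim_fst)
  have snd_lim: "((\<lambda>p. snd p) \<longlongrightarrow> x) (nhds a \<times>\<^sub>F nhds x)"
    by (rule filterlim_snd)
  have "((\<lambda>p. (fst p *\<^sub>R fst (snd p), fst p *\<^sub>R snd (snd p)))
      \<longlongrightarrow> (a *\<^sub>R fst x, a *\<^sub>R snd x)) (nhds a \<times>\<^sub>F nhds x)"
    by (intro tendsto_Pair tendsto_scaleR_lcs tendsto_fst tendsto_snd fst_lim snd_lim)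
  then show "LIM p (nhds a \<times>\<^sub>F nhds x). fst p *\<^sub>R snd p :> nhds (a *\<^sub>R x)"
    by (simp add: scaleR_prod_def)
next
  fix U :: "('a \<times> 'b) set"
  assume "open U" "0 \<in> U"
  then obtain A B where AB: "open A" "open B" "0 \<in> A \<times> B" "A \<times> B \<subseteq> U"
    by (rule open_prod_elim)
  from AB have "0 \<in> A" "0 \<in> B"
    by (auto simp: zero_prod_def)
  obtain V where V: "open V" "convex V" "0 \<in> V" "V \<subseteq> A"
    using locally_convex_0_convex[OF \<open>open A\<close> \<open>0 \<in> A\<close>] by blast
  obtain W where W: "open W" "convex W" "0 \<in> W" "W \<subseteq> B"
    using locally_convex_0_convex[OF \<open>open B\<close> \<open>0 \<in> B\<close>] by blast
  have "open (V \<times> W)" "convex (V \<times> W)" "0 \<in> V \<times> W" "V \<times> W \<subseteq> U"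
    using V W AB by (auto intro: open_Times convex_Times simp: zero_prod_def)
  then show "\<exists>V. open V \<and> 0 \<in> V \<and> V \<subseteq> U \<and>
      (\<forall>x\<in>V. \<forall>y\<in>V. \<forall>u\<ge>0. \<forall>v\<ge>0. u + v = 1 \<longrightarrow> u *\<^sub>R x + v *\<^sub>R y \<in> V)"
    unfolding convex_def by (intro exI[of _ "V \<times> W"] conjI)
qed

definition topological_dual :: "('a::locally_convex_space \<Rightarrow> real) set" where
  "topological_dual = {\<phi>. linear \<phi> \<and> continuous_on UNIV \<phi>}"

text \<open>
  The condition \<open>\<phi> \<noteq> 0\<close> makes these genuine half-spaces.  The empty set is then e-convex only if
  the space has a nonzero dual, which holds in every nontrivial separated locally convex space.
\<close>

definition open_halfspace :: "'a::locally_convex_space set \<Rightarrow> bool" where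
  "open_halfspace H \<longleftrightarrow>
     (\<exists>\<phi>\<in>topological_dual. \<phi> \<noteq> (\<lambda>_. 0) \<and> (\<exists>r. H = {y. \<phi> y < r}))"

definition e_convex :: "'a::locally_convex_space set \<Rightarrow> bool" where
  "e_convex C \<longleftrightarrow> (\<exists>\<H>. (\<forall>H\<in>\<H>. open_halfspace H) \<and> C = \<Inter>\<H>)"

definition e_conv :: "'a::locally_convex_space set \<Rightarrow> 'a set" where
  "e_conv C = \<Inter>{D. e_convex D \<and> C \<subseteq> D}"

text \<open>
  The polar cone uses the sign convention \<open>\<le> 0\<close>.  Throughout, sums of sets are the Minkowski
  sums of \<open>Set_Algebras\<close>.
\<close>

definition polar_cone :: "'z::locally_convex_space set \<Rightarrow> ('z \<Rightarrow> real) set" where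
  "polar_cone K = {\<phi>\<in>topological_dual. \<forall>z\<in>K. \<phi> z \<le> 0}"

definition le_K :: "'z::locally_convex_space set \<Rightarrow> 'z set \<Rightarrow> 'z set \<Rightarrow> bool" where
  "le_K K A B \<longleftrightarrow> B \<subseteq> A + K"

definition R_K :: "'z::locally_convex_space set \<Rightarrow> 'z set set" where
  "R_K K = {A. A = e_conv (A + K)}"

definition dom_set :: "('x \<Rightarrow> 'z set) \<Rightarrow> 'x set" where
  "dom_set f = {x. f x \<noteq> {}}"

definition proper_set :: "('x \<Rightarrow> 'z set) \<Rightarrow> bool" where
  "proper_set f \<longleftrightarrow> dom_set f \<noteq> {} \<and> (\<forall>x\<in>dom_set f. f x \<noteq> UNIV)"

definition f_plus :: "'z::locally_convex_space set \<Rightarrow> ('x \<Rightarrow> 'z set) \<Rightarrow> 'x \<Rightarrow> 'z set" where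
  "f_plus K f = (\<lambda>x. f x + K)"

definition epi_K :: "'z::locally_convex_space set \<Rightarrow> ('x \<Rightarrow> 'z set) \<Rightarrow> ('x \<times> 'z) set" where
  "epi_K K f = {(x, z). z \<in> f x + K}"

definition K_e_convex ::
    "'z::locally_convex_space set \<Rightarrow> ('x::locally_convex_space \<Rightarrow> 'z set) \<Rightarrow> bool" where
  "K_e_convex K f \<longleftrightarrow> e_convex (epi_K K f)"

definition S_map :: "('x \<Rightarrow> real) \<Rightarrow> ('z \<Rightarrow> real) \<Rightarrow> 'x \<Rightarrow> 'z set" where
  "S_map xs zs x = {z. xs x + zs z < 0}"

definition affine_on ::
    "'z::locally_convex_space set \<Rightarrow> 'x::locally_convex_space set \<Rightarrow> ('x \<Rightarrow> 'z set) \<Rightarrow> bool" where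
  "affine_on K C a \<longleftrightarrow>
     (\<exists>xs\<in>topological_dual. \<exists>zs\<in>polar_cone K - {\<lambda>_. 0}. \<exists>zt.
        \<forall>x. a x = (if x \<in> C then S_map xs zs x + {zt} else {}))"

text \<open>
  The empty set is an admissible domain \<open>C\<close>, so the map that is constantly empty is e-affine as soon
  as \<open>K\<close> has a nonzero polar functional.  If \<open>polar_cone K = {0}\<close> (that is, \<open>K\<close> is dense) there are
  no e-affine maps at all, and the supremum over the empty family is the whole space.
\<close>

definition e_affine ::
    "'z::locally_convex_space set \<Rightarrow> ('x::locally_convex_space \<Rightarrow> 'z set) \<Rightarrow> bool" where
  "e_affine K a \<longleftrightarrow> (\<forall>x. a x \<in> R_K K) \<and> (\<exists>C. e_convex C \<and> affine_on K C a)"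

definition e_affine_minorants ::
    "'z::locally_convex_space set \<Rightarrow> ('x::locally_convex_space \<Rightarrow> 'z set) \<Rightarrow> ('x \<Rightarrow> 'z set) set" where
  "e_affine_minorants K f = {a. e_affine K a \<and> (\<forall>x. le_K K (a x) (f x))}"

end

theory Submission
  imports Defs
begin

text \<open>
  An e-convex epigraph is an intersection of open half-spaces of the product space, and moving along
  \<open>K\<close> forces the second component of each of the defining functionals into the polar cone.  A
  half-space whose second component is nonzero is the graph of an affine minorant with full domain.
  A vertical half-space only restricts the domain; properness provides at least one non-vertical
  half-space, and restricting its minorant to the base of the vertical one excludes
  the same points.
\<close>

section \<open>Continuous functionals and their splitting on products\<close>

lemma topological_dual_zero: "(\<lambda>_. 0) \<in> topological_dual"
  by (simp add: topological_dual_def linear_iff)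

lemma topological_dual_add_prod:
  assumes "xs \<in> topological_dual" "zs \<in> topological_dual"
  shows "(\<lambda>(x, z). xs x + zs z) \<in> topological_dual"
proof -
  have "linear xs" "linear zs" and c: "continuous_on UNIV xs" "continuous_on UNIV zs"
    using assms by (auto simp: topological_dual_def)
  then have "linear (\<lambda>(x, z). xs x + zs z)"
    by (simp add: linear_iff case_prod_beta algebra_simps)
  moreover have "continuous_on UNIV (\<lambda>p. xs (fst p) + zs (snd p))"
    by (intro continuous_intros continuous_on_compose2[OF c(1)] continuous_on_compose2[OF c(2)]) auto
  ultimately show ?thesis
    by (simp add: topological_dual_def case_prod_beta)
qed

text \<open>The two components are the restrictions of \<open>\<phi>\<close> to the coordinate axes,
  which inherit linearity and continuity.\<close>

lemma topological_dual_prodE: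
  fixes \<phi> :: "'a::locally_convex_space \<times> 'b::locally_convex_space \<Rightarrow> real"
  assumes "\<phi> \<in> topological_dual"
  obtains xs zs where "xs \<in> topological_dual" "zs \<in> topological_dual"
    "\<And>x z. \<phi> (x, z) = xs x + zs z"
proof
  have lin: "linear \<phi>" and c: "continuous_on UNIV \<phi>"
    using assms by (auto simp: topological_dual_def)
  have add: "\<phi> (p + q) = \<phi> p + \<phi> q" and scale: "\<phi> (c *\<^sub>R p) = c * \<phi> p" for p q c
    using linear_add[OF lin] linear_scale[OF lin] by simp_all
  have "linear (\<lambda>x. \<phi> (x, 0))" "linear (\<lambda>z. \<phi> (0, z))"
    by (simp_all add: linear_iff add[symmetric] scale[symmetric])
  moreover have "continuous_on UNIV (\<lambda>x. \<phi> (x, 0))" "continuous_on UNIV (\<lambda>z. \<phi> (0, z))"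
    by (auto intro!: continuous_on_compose2[OF c] continuous_intros)
  ultimately show "(\<lambda>x. \<phi> (x, 0)) \<in> topological_dual" "(\<lambda>z. \<phi> (0, z)) \<in> topological_dual"
    by (auto simp: topological_dual_def)
  show "\<phi> (x, z) = \<phi> (x, 0) + \<phi> (0, z)" for x z
    by (simp add: add[symmetric])
qed

lemma linear_nonzero_surj:
  fixes \<phi> :: "'a::real_vector \<Rightarrow> real"
  assumes "linear \<phi>" "\<phi> \<noteq> (\<lambda>_. 0)"
  obtains y where "\<phi> y = r"
proof -
  obtain v where "\<phi> v \<noteq> 0"
    using assms(2) by auto
  then have "\<phi> ((r / \<phi> v) *\<^sub>R v) = r"
    using assms(1) by (simp add: linear_iff)
  then show ?thesis ..
qed

section \<open>E-convex sets: closure properties and separation\<close>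

lemma e_convexE:
  assumes "e_convex C"
  obtains \<H> where "\<forall>H\<in>\<H>. open_halfspace H" "C = \<Inter>\<H>"
  using assms unfolding e_convex_def by (elim exE conjE) (rule that)

lemma e_convex_UNIV: "e_convex UNIV"
  unfolding e_convex_def by (rule exI[of _ "{}"]) simp

lemma e_convex_Inter:
  assumes "\<And>C. C \<in> \<C> \<Longrightarrow> e_convex C"
  shows "e_convex (\<Inter>\<C>)"
proof -
  \<comment> \<open>Taking all half-spaces that contain the intersection avoids choosing a
    representing family for each member of \<open>\<C>\<close>.\<close>
  define \<H> where "\<H> = {H. open_halfspace H \<and> \<Inter>\<C> \<subseteq> H}"
  have "x \<in> C" if x: "x \<in> \<Inter>\<H>" and C: "C \<in> \<C>" for x C
  proof -
    obtain \<G> where \<G>: "\<forall>H\<in>\<G>. open_halfspace H" "C = \<Inter>\<G>"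
      by (rule e_convexE[OF assms[OF C]])
    have "\<G> \<subseteq> \<H>"
    proof
      fix H assume "H \<in> \<G>"
      then have "open_halfspace H" "C \<subseteq> H"
        using \<G> by auto
      then show "H \<in> \<H>"
        unfolding \<H>_def using C by blast
    qed
    then show ?thesis
      using x \<G>(2) by blast
  qed
  then have "\<Inter>\<C> = \<Inter>\<H>"
    by (auto simp: \<H>_def)
  moreover have "\<forall>H\<in>\<H>. open_halfspace H"
    by (simp add: \<H>_def)
  ultimately show ?thesis
    unfolding e_convex_def by blast
qed

lemma e_convex_Int:
  assumes "e_convex C" "e_convex D"
  shows "e_convex (C \<inter> D)"
  using e_convex_Inter[of "{C, D}"] assms by auto

lemma e_convex_halfspace:
  assumes "\<phi> \<in> topological_dual" "\<phi> \<noteq> (\<lambda>_. 0)"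
  shows "e_convex {y. \<phi> y < r}"
proof -
  have "open_halfspace {y. \<phi> y < r}"
    using assms unfolding open_halfspace_def by blast
  then show ?thesis
    unfolding e_convex_def by (intro exI[of _ "{{y. \<phi> y < r}}"]) simp
qed

text \<open>One nonzero functional suffices: its open half-spaces at all real levels have no common
  point, since \<open>y\<close> fails at level \<open>\<phi> y\<close>.\<close>

lemma e_convex_empty:
  fixes \<phi> :: "'a::locally_convex_space \<Rightarrow> real"
  assumes "\<phi> \<in> topological_dual" "\<phi> \<noteq> (\<lambda>_. 0)"
  shows "e_convex ({} :: 'a set)"
proof -
  have "(\<Inter>r. {y. \<phi> y < r}) = {}"
    using less_irrefl by blast
  moreover have "e_convex (\<Inter>r. {y. \<phi> y < r})"
    by (rule e_convex_Inter) (use e_convex_halfspace[OF assms] in auto)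
  ultimately show ?thesis by simp
qed

lemma e_convex_Times_UNIV:
  fixes C :: "'a::locally_convex_space set"
  assumes "e_convex C"
  shows "e_convex (C \<times> (UNIV :: 'b::locally_convex_space set))"
proof -
  obtain \<H> where \<H>: "\<forall>H\<in>\<H>. open_halfspace H" "C = \<Inter>\<H>"
    by (rule e_convexE[OF assms])
  have "e_convex (H \<times> (UNIV :: 'b set))" if H: "H \<in> \<H>" for H
  proof -
    obtain \<phi> r where \<phi>: "\<phi> \<in> topological_dual" "\<phi> \<noteq> (\<lambda>_. 0)" "H = {y. \<phi> y < r}"
      using bspec[OF \<H>(1) H] unfolding open_halfspace_def by blast
    \<comment> \<open>The summand 0 is the zero functional on the second factor, so that the rule
      for sums of functionals on a product applies.\<close>
    let ?\<psi> = "\<lambda>(x, z::'b). \<phi> x + 0"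
    have "?\<psi> \<in> topological_dual"
      using topological_dual_add_prod[OF \<phi>(1) topological_dual_zero] .
    moreover have "?\<psi> \<noteq> (\<lambda>_. 0)"
      using \<phi>(2) by (auto simp: fun_eq_iff)
    moreover have "H \<times> UNIV = {p. ?\<psi> p < r}"
      using \<phi>(3) by auto
    ultimately show ?thesis
      using e_convex_halfspace by metis
  qed
  moreover have "C \<times> (UNIV :: 'b set) = (\<Inter>H\<in>\<H>. H \<times> UNIV)"
    using \<H>(2) by auto
  ultimately show ?thesis
    using e_convex_Inter[of "(\<lambda>H. H \<times> (UNIV :: 'b set)) ` \<H>"] by auto
qed

lemma e_conv_e_convex:
  assumes "e_convex C"
  shows "e_conv C = C"
  using assms unfolding e_conv_def by blast

lemma e_convex_separation:
  assumes "e_convex C" "y \<notin> C"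
  obtains \<phi> r where "\<phi> \<in> topological_dual" "\<phi> \<noteq> (\<lambda>_. 0)" "\<And>x. x \<in> C \<Longrightarrow> \<phi> x < r" "r \<le> \<phi> y"
proof -
  obtain \<H> where \<H>: "\<forall>H\<in>\<H>. open_halfspace H" "C = \<Inter>\<H>"
    by (rule e_convexE[OF assms(1)])
  then obtain H where "H \<in> \<H>" "y \<notin> H"
    using assms(2) by auto
  then have "open_halfspace H" "C \<subseteq> H"
    using \<H> by auto
  with \<open>y \<notin> H\<close> obtain \<phi> r where "\<phi> \<in> topological_dual" "\<phi> \<noteq> (\<lambda>_. 0)"
    "C \<subseteq> {x. \<phi> x < r}" "\<not> \<phi> y < r"
    unfolding open_halfspace_def by auto
  then show ?thesis
    using that[of \<phi> r] by auto
qed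

section \<open>Sums with the cone, affine maps and their minorants\<close>

lemma subset_plus_cone:
  fixes A K :: "'a::monoid_add set"
  assumes "0 \<in> K"
  shows "A \<subseteq> A + K"
  using assms set_plus_intro[of _ A 0 K] by auto

lemma plus_cone_closed:
  fixes K :: "'a::real_vector set"
  assumes "convex K" "cone K" "z \<in> A + K" "k \<in> K"
  shows "z + k \<in> A + K"
proof -
  obtain a k' where "z = a + k'" "a \<in> A" "k' \<in> K"
    using assms(3) by (auto elim: set_plus_elim)
  moreover have "k' + k \<in> K"
    using assms \<open>k' \<in> K\<close> convex_cone by blast
  ultimately show ?thesis
    by (simp add: add.assoc set_plus_intro)
qed

text \<open>Moving along \<open>K\<close> never increases a polar functional, so a strict upper
  bound survives; this is how affine maps absorb \<open>K\<close>.\<close>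

lemma halfspace_plus_polar:
  assumes "zs \<in> polar_cone K" "0 \<in> K"
  shows "{z. zs z < r} + K = {z. zs z < r}"
proof
  have le: "zs (a + k) \<le> zs a" if "k \<in> K" for a k
    using assms(1) that by (simp add: polar_cone_def topological_dual_def linear_iff)
  show "{z. zs z < r} + K \<subseteq> {z. zs z < r}"
    using le_less_trans[OF le] by (auto elim!: set_plus_elim)
qed (rule subset_plus_cone[OF assms(2)])

lemma polar_zero: "(\<lambda>_. 0) \<in> polar_cone K"
  by (simp add: polar_cone_def topological_dual_zero)

text \<open>
  The translation vector of an affine map is recorded only through its value under the polar
  functional, which can be an arbitrary real number.
\<close>

lemma e_affine_iff:
  fixes K :: "'z::locally_convex_space set" and a :: "'x::locally_convex_space \<Rightarrow> 'z set"
  assumes "0 \<in> K"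
  shows "e_affine K a \<longleftrightarrow>
    (\<exists>C xs zs r. e_convex C \<and> xs \<in> topological_dual \<and> zs \<in> polar_cone K \<and> zs \<noteq> (\<lambda>_. 0) \<and>
      a = (\<lambda>x. if x \<in> C then {z. xs x + zs z < r} else {}))" (is "_ \<longleftrightarrow> ?R")
proof
  have S: "S_map xs zs x + {zt} = {z. xs x + zs z < zs zt}" if "linear zs"
    for xs :: "'x \<Rightarrow> real" and zs x zt
  proof (intro set_eqI iffI)
    fix z assume "z \<in> S_map xs zs x + {zt}"
    then show "z \<in> {z. xs x + zs z < zs zt}"
      using linear_add[OF that] by (auto simp: S_map_def set_plus_def)
  next
    fix z assume "z \<in> {z. xs x + zs z < zs zt}"
    then have "z - zt \<in> S_map xs zs x"
      by (simp add: S_map_def linear_diff[OF that])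
    then have "(z - zt) + zt \<in> S_map xs zs x + {zt}"
      by (intro set_plus_intro) auto
    then show "z \<in> S_map xs zs x + {zt}" by simp
  qed
  {
    assume "e_affine K a"
    then obtain C xs zs zt where *: "e_convex C" "xs \<in> topological_dual"
      "zs \<in> polar_cone K" "zs \<noteq> (\<lambda>_. 0)" "\<And>x. a x = (if x \<in> C then S_map xs zs x + {zt} else {})"
      unfolding e_affine_def affine_on_def by blast
    then have "linear zs"
      by (simp add: polar_cone_def topological_dual_def)
    then have "a = (\<lambda>x. if x \<in> C then {z. xs x + zs z < zs zt} else {})"
      using *(5) by (simp add: S fun_eq_iff)
    then show ?R
      using * by blast
  }
  assume ?R
  then obtain C xs zs r where *: "e_convex C" "xs \<in> topological_dual"
    "zs \<in> polar_cone K" "zs \<noteq> (\<lambda>_. 0)" "a = (\<lambda>x. if x \<in> C then {z. xs x + zs z < r} else {})"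
    by blast
  then have dual: "zs \<in> topological_dual" and lin: "linear zs"
    by (auto simp: polar_cone_def topological_dual_def)
  obtain zt where "zs zt = r"
    using linear_nonzero_surj[OF lin *(4)] .
  then have "affine_on K C a"
    unfolding affine_on_def using * S[OF lin, of xs _ zt]
    by (intro bexI[of _ xs] bexI[of _ zs] exI[of _ zt]) auto
  moreover have "a x \<in> R_K K" for x
  proof (cases "x \<in> C")
    case True
    then have ax: "a x = {z. zs z < r - xs x}"
      using *(5) by auto
    then show ?thesis
      unfolding R_K_def mem_Collect_eq ax halfspace_plus_polar[OF *(3) assms]
      by (simp add: e_conv_e_convex e_convex_halfspace[OF dual *(4)])
  next
    case False
    then show ?thesis
      \<comment> \<open>Off the domain the value is empty, and the nonzero \<open>zs\<close> itself
        witnesses that the empty set of \<open>Z\<close> is e-convex.\<close>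
      using *(5) by (simp add: R_K_def e_conv_e_convex e_convex_empty[OF dual *(4)] set_plus_def)
  qed
  ultimately show "e_affine K a"
    unfolding e_affine_def using *(1) by blast
qed

lemma e_affine_plus_cone:
  assumes "0 \<in> K" "e_affine K a"
  shows "a x + K = a x"
proof -
  obtain C xs zs r where *: "zs \<in> polar_cone K"
    "a = (\<lambda>x. if x \<in> C then {z. xs x + zs z < r} else {})"
    using assms(2) unfolding e_affine_iff[OF assms(1)] by blast
  show ?thesis
  proof (cases "x \<in> C")
    case True
    then have ax: "a x = {z. zs z < r - xs x}"
      using *(2) by auto
    show ?thesis
      unfolding ax by (rule halfspace_plus_polar[OF *(1) assms(1)])
  qed (simp add: *(2) set_plus_def)
qed

lemma e_affine_ne_UNIV:
  assumes "0 \<in> K" "e_affine K a"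
  shows "a x \<noteq> UNIV"
proof
  assume eq: "a x = UNIV"
  obtain C xs zs r where *: "zs \<in> polar_cone K" "zs \<noteq> (\<lambda>_. 0)"
    "a = (\<lambda>x. if x \<in> C then {z. xs x + zs z < r} else {})"
    using assms(2) unfolding e_affine_iff[OF assms(1)] by blast
  have "linear zs"
    using *(1) by (simp add: polar_cone_def topological_dual_def)
  \<comment> \<open>A point exactly on the boundary level violates the strict inequality; if
    \<open>x\<close> lies outside \<open>C\<close>, the value is empty anyway.\<close>
  then obtain z where "zs z = r - xs x"
    using linear_nonzero_surj *(2) by blast
  then have "z \<notin> a x"
    using *(3) by simp
  then show False
    using eq by simp
qed

text \<open>The graph is a cylinder over the e-convex domain \<open>C\<close>, cut by one open
  half-space of the product.\<close>

lemma e_affine_graph_e_convex: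
  assumes "0 \<in> K" "e_affine K a"
  shows "e_convex {(x, z). z \<in> a x}"
proof -
  obtain C xs zs r where *: "e_convex C" "xs \<in> topological_dual"
    "zs \<in> polar_cone K" "zs \<noteq> (\<lambda>_. 0)" "a = (\<lambda>x. if x \<in> C then {z. xs x + zs z < r} else {})"
    using assms(2) unfolding e_affine_iff[OF assms(1)] by blast
  let ?\<psi> = "\<lambda>(x, z). xs x + zs z"
  have "?\<psi> \<in> topological_dual"
    using * by (intro topological_dual_add_prod) (auto simp: polar_cone_def)
  moreover have "?\<psi> \<noteq> (\<lambda>_. 0)"
  proof
    assume "?\<psi> = (\<lambda>_. 0)"
    then have "?\<psi> (0, z) = 0" for z
      by metis
    moreover have "xs 0 = 0"
      using *(2) by (simp add: topological_dual_def linear_0)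
    ultimately show False
      using *(4) by auto
  qed
  ultimately have "e_convex ((C \<times> UNIV) \<inter> {p. ?\<psi> p < r})"
    by (intro e_convex_Int e_convex_Times_UNIV e_convex_halfspace *(1))
  moreover have "{(x, z). z \<in> a x} = (C \<times> UNIV) \<inter> {p. ?\<psi> p < r}"
    using *(5) by (auto split: if_splits)
  ultimately show ?thesis
    by simp
qed

text \<open>Since \<open>a x\<close> absorbs \<open>K\<close>, adding \<open>K\<close> to both sides
  of \<open>f x \<subseteq> a x\<close> changes nothing. Minorants are thus the affine maps whose
  graph contains the epigraph.\<close>

lemma e_affine_minorants_iff:
  assumes "0 \<in> K"
  shows "a \<in> e_affine_minorants K f \<longleftrightarrow> e_affine K a \<and> (\<forall>x. f x + K \<subseteq> a x)"
proof -
  have "f x \<subseteq> a x \<longleftrightarrow> f x + K \<subseteq> a x" if "e_affine K a" for x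
  proof
    assume "f x \<subseteq> a x"
    then have "f x + K \<subseteq> a x + K"
      by (intro set_plus_mono2) simp_all
    then show "f x + K \<subseteq> a x"
      unfolding e_affine_plus_cone[OF assms that] .
  next
    assume "f x + K \<subseteq> a x"
    then show "f x \<subseteq> a x"
      using subset_plus_cone[OF assms, of "f x"] by (rule subset_trans[rotated])
  qed
  then show ?thesis
    unfolding e_affine_minorants_def le_K_def mem_Collect_eq
    by (metis e_affine_plus_cone[OF assms])
qed

section \<open>Separating points from the epigraph by affine minorants\<close>

lemma polar_cone_if_bounded_on_translate:
  assumes "convex K" "cone K" "zs \<in> topological_dual" "z0 \<in> A + K"
    and bound: "\<And>z. z \<in> A + K \<Longrightarrow> zs z < r"
  shows "zs \<in> polar_cone K"
proof -
  have lin: "linear zs"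
    using assms(3) by (simp add: topological_dual_def)
  have "zs k \<le> 0" if "k \<in> K" for k
  proof (rule ccontr)
    assume "\<not> zs k \<le> 0"
    \<comment> \<open>The ray from \<open>z0\<close> in direction \<open>k\<close> stays in
      \<open>A + K\<close>; \<open>t\<close> is the parameter at which \<open>zs\<close> reaches the
      forbidden level \<open>r\<close>.\<close>
    moreover define t where "t = (r - zs z0) / zs k"
    moreover have "zs z0 < r"
      using bound assms(4) .
    ultimately have "t \<ge> 0" and t: "t * zs k = r - zs z0"
      by auto
    then have "t *\<^sub>R k \<in> K"
      using assms(2) that by (simp add: cone_def)
    then have "zs (z0 + t *\<^sub>R k) < r"
      by (intro bound plus_cone_closed assms)
    then show False
      using lin t by (simp add: linear_iff)
  qed
  then show ?thesis
    using assms(3) by (simp add: polar_cone_def)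
qed

text \<open>The nonempty value at \<open>x1\<close> supplies a fibre of the epigraph that is closed
  under adding \<open>K\<close>; boundedness of the functional there makes \<open>zs\<close>
  polar.\<close>

lemma epi_separation:
  fixes f :: "'x::locally_convex_space \<Rightarrow> 'z::locally_convex_space set"
  assumes "convex K" "cone K" "K_e_convex K f" "f x1 + K \<noteq> {}" "z0 \<notin> f x0 + K"
  obtains xs zs r where "xs \<in> topological_dual" "zs \<in> polar_cone K"
    "xs \<noteq> (\<lambda>_. 0) \<or> zs \<noteq> (\<lambda>_. 0)" "\<And>x z. z \<in> f x + K \<Longrightarrow> xs x + zs z < r" "r \<le> xs x0 + zs z0"
proof -
  have "e_convex (epi_K K f)" "(x0, z0) \<notin> epi_K K f"
    using assms(3,5) by (auto simp: K_e_convex_def epi_K_def)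
  then obtain \<phi> r where \<phi>: "\<phi> \<in> topological_dual" "\<phi> \<noteq> (\<lambda>_. 0)"
    "\<And>p. p \<in> epi_K K f \<Longrightarrow> \<phi> p < r" "r \<le> \<phi> (x0, z0)"
    by (metis e_convex_separation)
  obtain xs zs where split: "xs \<in> topological_dual" "zs \<in> topological_dual"
    "\<And>x z. \<phi> (x, z) = xs x + zs z"
    by (rule topological_dual_prodE[OF \<phi>(1)]) (rule that)
  have bound: "xs x + zs z < r" if "z \<in> f x + K" for x z
    using \<phi>(3)[of "(x, z)"] that by (simp add: epi_K_def split)
  obtain z1 where "z1 \<in> f x1 + K"
    using assms(4) by blast
  then have "zs \<in> polar_cone K"
    using assms(1,2) split(2) bound[of _ x1]
    \<comment> \<open>On the fibre over \<open>x1\<close> the term \<open>xs x1\<close> is constant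
      and moves into the level.\<close>
    by (intro polar_cone_if_bounded_on_translate[of K zs z1 "f x1" "r - xs x1"]) force+
  moreover have "xs \<noteq> (\<lambda>_. 0) \<or> zs \<noteq> (\<lambda>_. 0)"
    using \<phi>(2) split(3) by (auto simp: fun_eq_iff)
  moreover have "r \<le> xs x0 + zs z0"
    using \<phi>(4) split(3) by simp
  ultimately show ?thesis
    by (intro that[OF split(1) _ _ bound])
qed

lemma minorant_excluding_point:
  fixes f :: "'x::locally_convex_space \<Rightarrow> 'z::locally_convex_space set"
  assumes K: "convex K" "cone K" "0 \<in> K" and "K_e_convex K f" "proper_set (f_plus K f)"
    and "z0 \<notin> f x0 + K"
  obtains a where "a \<in> e_affine_minorants K f" "z0 \<notin> a x0"
proof -
  obtain x1 where ne: "f x1 + K \<noteq> {}" and "f x1 + K \<noteq> UNIV"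
    using assms(5) by (auto simp: proper_set_def dom_set_def f_plus_def)
  \<comment> \<open>A point missing over the nonempty fibre at \<open>x1\<close> can only be cut off
    by a non-vertical half-space. It is kept in reserve for the vertical case.\<close>
  then obtain z1 where z1: "z1 \<notin> f x1 + K"
    by blast
  note sep = epi_separation[OF K(1,2) assms(4) ne]
  obtain xs zs r where s: "xs \<in> topological_dual" "zs \<in> polar_cone K"
    "xs \<noteq> (\<lambda>_. 0) \<or> zs \<noteq> (\<lambda>_. 0)" "\<And>x z. z \<in> f x + K \<Longrightarrow> xs x + zs z < r" "r \<le> xs x0 + zs z0"
    by (rule sep[OF assms(6)]) (rule that)
  show ?thesis
  proof (cases "zs = (\<lambda>_. 0)")
    case False
    \<comment> \<open>The vacuous condition puts full domain into the form required by
      \<open>e_affine_iff\<close>.\<close>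
    define a where "a = (\<lambda>x. if x \<in> UNIV then {z. xs x + zs z < r} else {})"
    have "e_affine K a"
      unfolding e_affine_iff[OF K(3)] a_def using e_convex_UNIV s(1,2) False by blast
    then have "a \<in> e_affine_minorants K f"
      using s(4) by (auto simp: e_affine_minorants_iff[OF K(3)] a_def)
    then show ?thesis
      using that s(5) by (auto simp: a_def)
  next
    case True
    obtain xs' zs' r' where s': "xs' \<in> topological_dual" "zs' \<in> polar_cone K"
      "\<And>x z. z \<in> f x + K \<Longrightarrow> xs' x + zs' z < r'" "r' \<le> xs' x1 + zs' z1"
      by (rule sep[OF z1]) (rule that)
    have "zs' \<noteq> (\<lambda>_. 0)"
      \<comment> \<open>Otherwise \<open>x1\<close>, a point of the domain, would lie outside the half-space.\<close>
    proof
      assume "zs' = (\<lambda>_. 0)"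
      moreover obtain z where "z \<in> f x1 + K"
        using ne by blast
      ultimately show False
        using s'(3)[of z x1] s'(4) by simp
    qed
    moreover have "e_convex {x. xs x < r}"
      using s(1,3) True by (simp add: e_convex_halfspace)
    \<comment> \<open>The domain contains every point where \<open>f x + K\<close> is nonempty, so
      \<open>a\<close> remains a minorant. It omits \<open>x0\<close>, because
      \<open>r \<le> xs x0\<close> once \<open>zs\<close> vanishes.\<close>
    moreover define a where "a = (\<lambda>x. if x \<in> {x. xs x < r} then {z. xs' x + zs' z < r'} else {})"
    ultimately have "e_affine K a"
      unfolding e_affine_iff[OF K(3)] using s'(1,2) by blast
    then have "a \<in> e_affine_minorants K f"
      using s(4) s'(3) True by (auto simp: e_affine_minorants_iff[OF K(3)] a_def)
    then show ?thesis
      using that s(5) True by (auto simp: a_def)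
  qed
qed

theorem theorem3:
  fixes K :: "'z::locally_convex_space set"
    and f :: "'x::locally_convex_space \<Rightarrow> 'z set"
  assumes X_nontrivial: "(UNIV :: 'x set) \<noteq> {0}"
    and Z_nontrivial: "(UNIV :: 'z set) \<noteq> {0}"
    and K_convex: "convex K"
    and K_cone: "cone K"
    and K_nonzero: "{0} \<subset> K"
    and K_proper: "K \<subset> UNIV"
    and polar_nonzero: "(\<forall>x. f x = {}) \<Longrightarrow> polar_cone K \<noteq> {\<lambda>_. 0}"
  shows "(\<forall>x. f x + K = (\<Inter>a\<in>e_affine_minorants K f. a x + K)) \<longleftrightarrow>
    K_e_convex K f \<and>
      (proper_set (f_plus K f) \<or> (\<forall>x. f_plus K f x = {}) \<or> (\<forall>x. f_plus K f x = UNIV))"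
proof -
  have K0: "0 \<in> K"
    using K_nonzero by auto
  let ?M = "e_affine_minorants K f"
  have M_plus: "a x + K = a x" if "a \<in> ?M" for a x
    using that by (intro e_affine_plus_cone[OF K0]) (simp add: e_affine_minorants_iff[OF K0])
  have sup_eq: "(\<Inter>a\<in>?M. a x + K) = (\<Inter>a\<in>?M. a x)" for x
    using M_plus by simp
  show ?thesis
    unfolding sup_eq
  proof
    assume sup: "\<forall>x. f x + K = (\<Inter>a\<in>?M. a x)"
    then have "epi_K K f = (\<Inter>a\<in>?M. {(x, z). z \<in> a x})"
      by (auto simp: epi_K_def)
    moreover have "e_convex (\<Inter>a\<in>?M. {(x, z). z \<in> a x})"
      by (rule e_convex_Inter)
        (auto simp: e_affine_minorants_iff[OF K0] intro: e_affine_graph_e_convex[OF K0])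
    ultimately have "K_e_convex K f"
      by (simp add: K_e_convex_def)
    \<comment> \<open>Without minorants the supremum is the whole space everywhere; a single
      minorant keeps every value away from it. Mixed behaviour is therefore impossible.\<close>
    moreover have "(\<forall>x. f x + K = UNIV) \<or> (\<forall>x. f x + K \<noteq> UNIV)"
    proof (cases "?M = {}")
      case True
      then show ?thesis
        using sup by simp
    next
      case False
      then obtain a where a: "a \<in> ?M"
        by blast
      then have "e_affine K a"
        by (simp add: e_affine_minorants_iff[OF K0])
      then have "a x \<noteq> UNIV" for x
        by (rule e_affine_ne_UNIV[OF K0])
      moreover have "f x + K \<subseteq> a x" for x
        using a by (simp add: e_affine_minorants_iff[OF K0])
      ultimately show ?thesis
        by (metis top.extremum_unique)
    qed
    then have "proper_set (f_plus K f) \<or> (\<forall>x. f_plus K f x = {}) \<or> (\<forall>x. f_plus K f x = UNIV)"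
      unfolding proper_set_def dom_set_def f_plus_def by blast
    ultimately show "K_e_convex K f \<and>
      (proper_set (f_plus K f) \<or> (\<forall>x. f_plus K f x = {}) \<or> (\<forall>x. f_plus K f x = UNIV))" ..
  next
    assume R: "K_e_convex K f \<and>
      (proper_set (f_plus K f) \<or> (\<forall>x. f_plus K f x = {}) \<or> (\<forall>x. f_plus K f x = UNIV))"
    have lower: "f x + K \<subseteq> (\<Inter>a\<in>?M. a x)" for x
      by (intro INT_greatest) (simp add: e_affine_minorants_iff[OF K0])
    consider "proper_set (f_plus K f)" | "\<And>x. f x + K = {}" | "\<And>x. f x + K = UNIV"
      using R by (auto simp: f_plus_def)
    then show "\<forall>x. f x + K = (\<Inter>a\<in>?M. a x)"
    proof cases
      case 1
      have "z \<in> f x + K" if "z \<in> (\<Inter>a\<in>?M. a x)" for x z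
        using that minorant_excluding_point[OF K_convex K_cone K0 conjunct1[OF R] 1] by blast
      then show ?thesis
        using lower by blast
    next
      case 2
      \<comment> \<open>This activates the hypothesis \<open>polar_nonzero\<close>, which provides
        the functional for building minorants.\<close>
      then have "\<forall>x. f x = {}"
        using subset_plus_cone[OF K0] by blast
      then obtain zs where zs: "zs \<in> polar_cone K" "zs \<noteq> (\<lambda>_. 0)"
        using polar_nonzero polar_zero by blast
      \<comment> \<open>Full-domain maps with arbitrary level avoid the map with empty domain, whose e-convexity
        would need a nonzero functional on \<open>X\<close> and hence the Hahn-Banach theorem.\<close>
      have "(\<lambda>x. {z. zs z < r}) \<in> ?M" for r
      proof -
        have "e_affine K (\<lambda>x::'x. {z. zs z < r})"
          unfolding e_affine_iff[OF K0] using e_convex_UNIV topological_dual_zero zs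
          by (intro exI[of _ UNIV] exI[of _ "\<lambda>_. 0"] exI[of _ zs] exI[of _ r]) auto
        then show ?thesis
          using 2 by (simp add: e_affine_minorants_iff[OF K0])
      qed
      \<comment> \<open>The minorant of level \<open>r = zs z\<close> excludes
        \<open>z\<close>.\<close>
      then have "z \<notin> (\<Inter>a\<in>?M. a x)" for x z
        by (metis (no_types, lifting) INT_D less_irrefl mem_Collect_eq)
      then show ?thesis
        using 2 by blast
    next
      \<comment> \<open>All values of \<open>f x + K\<close> are already maximal, so the inclusion
        \<open>lower\<close> forces equality.\<close>
      case 3
      then show ?thesis
        using lower by blast
    qed
  qed
qed

end
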